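(* Let $0<\ell_1\le\ell_2\le\ell_3$ and $r_k=\cosh(\ell_k/2)$. Any ultra-parallel $[\ell_1,\ell_2,\ell_3]$-triangle group such that $$r_1^2+r_2^2+r_3^2=1+2r_1r_2r_3,$$ i.e. any ultra-parallel $[\ell_1,\ell_2,\ell_1+\ell_2]$-triangle group, is of type B.
   Context: $\mathbb C^{2,1}$ is $\mathbb C^3$ with the Hermitian form $\langle z,w\rangle=z_1\bar w_1+z_2\bar w_2-z_3\bar w_3$. The complex hyperbolic plane $H^2_{\mathbb C}$ is the projectivisation of the set of vectors with $\langle z,z\rangle<0$; its holomorphic isometry group is $\mathrm{PU}(2,1)$. A complex geodesic $C$ is the projectivisation (intersected with $H^2_{\mathbb C}$) of the orthogonal complement of a vector $c$ with $\langle c,c\rangle>0$; $c$ is called a polar vector of $C$, normalised if $\langle c,c\rangle=1$. Two complex geodesics with normalised polar vectors $c,c'$ are ultra-parallel (their closures in $H^2_{\mathbb C}\cup\partial H^2_{\mathbb C}$ are disjoint) iff $|\langle c,c'\rangle|>1$, and then $|\langle c,c'\rangle|=\cosh(\ell/2)$ with $\ell$ the distance between them. An ultra-parallel $[\ell_1,\ell_2,\ell_3]$-triangle is a triple $(C_1,C_2,C_3)$ of complex geodesics, with normalised polar vectors $c_k$ (indices mod 3), such that $C_{k-1}$ and $C_{k+1}$ are ultra-parallel with distance $\ell_k$, so $|\langle c_{k-1},c_{k+1}\rangle|=r_k=\cosh(\ell_k/2)$. Its angular invariant is $\alpha=\arg\left(\prod_{k=1}^3\langle c_{k-1},c_{k+1}\rangle\right)$.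 The complex reflection in $C_k$ is $\iota_k(z)=-z+2\langle z,c_k\rangle c_k$, and the $[\ell_1,\ell_2,\ell_3]$-triangle group is generated by $\iota_1,\iota_2,\iota_3$. For fixed $[\ell_1,\ell_2,\ell_3]$ these groups are parameterised, up to conjugation, by $t=\cot(\alpha/2)\in(-t_\infty,t_\infty)$, where $t_\infty=\sqrt{(1+c_\infty)/(1-c_\infty)}$, $c_\infty=\frac{r_1^2+r_2^2+r_3^2-1}{2r_1r_2r_3}$; under the identity in the claim one has $c_\infty=1$ and $t_\infty=+\infty$, so $t$ ranges over all of $\mathbb R$. The values $t$ and $-t$ give groups conjugate by an antiholomorphic isometry. Put $w_A=\iota_3\iota_2\iota_3\iota_1$ and $w_B=\iota_1\iota_2\iota_3$. An isometry is elliptic if it has a fixed point in $H^2_{\mathbb C}$. The triangle group (i.e. the triple $[\ell_1,\ell_2,\ell_3]$) is of type A if $w_A$ becomes elliptic before $w_B$ as $t$ increases from $0$, i.e. if $\inf\{t\ge0: w_A\text{ is elliptic}\}<\inf\{t\ge0: w_B\text{ is elliptic}\}$ (with $\inf\emptyset=+\infty$); otherwise it is of type B. *)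

theory Defs
  imports "HOL-Analysis.Analysis"
begin

definition herm :: "complex ^ 3 \<Rightarrow> complex ^ 3 \<Rightarrow> complex"
  where "herm z w = z $ 1 * cnj (w $ 1) + z $ 2 * cnj (w $ 2) - z $ 3 * cnj (w $ 3)"

text \<open>The values \<open>herm z z\<close> are real, so signs and magnitudes are read off \<open>Re (herm z z)\<close>.\<close>

definition negative :: "complex ^ 3 \<Rightarrow> bool"
  where "negative z \<longleftrightarrow> Re (herm z z) < 0"

text \<open>A point of the projective plane is the complex line spanned by a representative.\<close>

definition proj :: "complex ^ 3 \<Rightarrow> (complex ^ 3) set"
  where "proj z = range (\<lambda>a. a *s z)"

definition H2C :: "(complex ^ 3) set set"
  where "H2C = proj ` {z. negative z}"

definition complex_geodesic :: "complex ^ 3 \<Rightarrow> (complex ^ 3) set set"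
  where "complex_geodesic c = proj ` {z. negative z \<and> herm z c = 0}"

text \<open>The Bergman metric, normalised by
  \<open>cosh\<^sup>2 (d / 2) = \<langle>z,w\<rangle> \<langle>w,z\<rangle> / (\<langle>z,z\<rangle> \<langle>w,w\<rangle>)\<close>, i.e. with holomorphic sectional curvature \<open>- 1\<close>,
  in terms of negative representatives \<open>z\<close> and \<open>w\<close> of the two points.
  This is the normalisation for which ultra-parallel geodesics with normalised polar vectors
  \<open>c\<close>, \<open>c'\<close> at distance \<open>l\<close> satisfy \<open>\<bar>\<langle>c,c'\<rangle>\<bar> = cosh (l / 2)\<close>.\<close>

definition hyp_dist :: "complex ^ 3 \<Rightarrow> complex ^ 3 \<Rightarrow> real"
  where "hyp_dist z w =
    2 * arcosh (cmod (herm z w) / sqrt (Re (herm z z) * Re (herm w w)))"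

definition set_hyp_dist :: "(complex ^ 3) set set \<Rightarrow> (complex ^ 3) set set \<Rightarrow> real"
  where "set_hyp_dist C D = Inf {hyp_dist z w | z w. proj z \<in> C \<and> proj w \<in> D}"

text \<open>Every point of \<open>H\<^sup>2 \<union> \<partial>H\<^sup>2\<close> has nonzero third coordinate, and the chart
  \<open>[z] \<mapsto> (z\<^sub>1 / z\<^sub>3, z\<^sub>2 / z\<^sub>3)\<close> is a homeomorphism from \<open>H\<^sup>2 \<union> \<partial>H\<^sup>2\<close> onto the closed unit ball
  of \<open>\<complex>\<^sup>2\<close>. Hence closures in \<open>H\<^sup>2 \<union> \<partial>H\<^sup>2\<close> may be taken in this chart.\<close>

definition ball_chart :: "(complex ^ 3) set set \<Rightarrow> (complex ^ 2) set"
  where "ball_chart C = {vector [z $ 1 / z $ 3, z $ 2 / z $ 3] | z. proj z \<in> C}"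

definition ultra_parallel :: "(complex ^ 3) set set \<Rightarrow> (complex ^ 3) set set \<Rightarrow> bool"
  where "ultra_parallel C D \<longleftrightarrow> closure (ball_chart C) \<inter> closure (ball_chart D) = {}"

text \<open>The triangle is given by normalised polar vectors of its three sides.\<close>

definition ultra_parallel_triangle ::
  "real \<Rightarrow> real \<Rightarrow> real \<Rightarrow> complex ^ 3 \<Rightarrow> complex ^ 3 \<Rightarrow> complex ^ 3 \<Rightarrow> bool"
  where "ultra_parallel_triangle l1 l2 l3 c1 c2 c3 \<longleftrightarrow>
    herm c1 c1 = 1 \<and> herm c2 c2 = 1 \<and> herm c3 c3 = 1 \<and>
    ultra_parallel (complex_geodesic c3) (complex_geodesic c2) \<and>
    ultra_parallel (complex_geodesic c1) (complex_geodesic c3) \<and>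
    ultra_parallel (complex_geodesic c2) (complex_geodesic c1) \<and>
    set_hyp_dist (complex_geodesic c3) (complex_geodesic c2) = l1 \<and>
    set_hyp_dist (complex_geodesic c1) (complex_geodesic c3) = l2 \<and>
    set_hyp_dist (complex_geodesic c2) (complex_geodesic c1) = l3"

definition angular_invariant :: "complex ^ 3 \<Rightarrow> complex ^ 3 \<Rightarrow> complex ^ 3 \<Rightarrow> real"
  where "angular_invariant c1 c2 c3 = Arg (herm c3 c2 * herm c1 c3 * herm c2 c1)"

text \<open>With \<open>\<alpha> \<in> (-\<pi>, \<pi>]\<close>, the parameter \<open>cot (\<alpha> / 2)\<close> is a real number unless \<open>\<alpha> = 0\<close>, where it is
  infinite. That case is excluded explicitly because \<open>cot 0 = 0\<close> here.\<close>

definition has_parameter :: "complex ^ 3 \<Rightarrow> complex ^ 3 \<Rightarrow> complex ^ 3 \<Rightarrow> real \<Rightarrow> bool"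
  where "has_parameter c1 c2 c3 t \<longleftrightarrow>
    angular_invariant c1 c2 c3 \<noteq> 0 \<and> t = cot (angular_invariant c1 c2 c3 / 2)"

definition c_infinity :: "real \<Rightarrow> real \<Rightarrow> real \<Rightarrow> real"
  where "c_infinity l1 l2 l3 =
    ((cosh (l1 / 2))\<^sup>2 + (cosh (l2 / 2))\<^sup>2 + (cosh (l3 / 2))\<^sup>2 - 1) /
    (2 * cosh (l1 / 2) * cosh (l2 / 2) * cosh (l3 / 2))"

definition t_infinity :: "real \<Rightarrow> real \<Rightarrow> real \<Rightarrow> ereal"
  where "t_infinity l1 l2 l3 =
    (if c_infinity l1 l2 l3 < 1
     then ereal (sqrt ((1 + c_infinity l1 l2 l3) / (1 - c_infinity l1 l2 l3)))
     else \<infinity>)"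

definition complex_reflection :: "complex ^ 3 \<Rightarrow> complex ^ 3 \<Rightarrow> complex ^ 3"
  where "complex_reflection c z = - z + (2 * herm z c) *s c"

definition word_A :: "complex ^ 3 \<Rightarrow> complex ^ 3 \<Rightarrow> complex ^ 3 \<Rightarrow> complex ^ 3 \<Rightarrow> complex ^ 3"
  where "word_A c1 c2 c3 =
    complex_reflection c3 \<circ> complex_reflection c2 \<circ> complex_reflection c3 \<circ> complex_reflection c1"

definition word_B :: "complex ^ 3 \<Rightarrow> complex ^ 3 \<Rightarrow> complex ^ 3 \<Rightarrow> complex ^ 3 \<Rightarrow> complex ^ 3"
  where "word_B c1 c2 c3 =
    complex_reflection c1 \<circ> complex_reflection c2 \<circ> complex_reflection c3"

definition elliptic :: "(complex ^ 3 \<Rightarrow> complex ^ 3) \<Rightarrow> bool"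
  where "elliptic f \<longleftrightarrow> (\<exists>p \<in> H2C. f ` p = p)"

text \<open>The triangle with given side data and parameter \<open>t\<close> is unique up to isometry, so
  it does not matter which triangle realising \<open>t\<close> is used to test ellipticity.\<close>

definition elliptic_parameters ::
  "(complex ^ 3 \<Rightarrow> complex ^ 3 \<Rightarrow> complex ^ 3 \<Rightarrow> complex ^ 3 \<Rightarrow> complex ^ 3) \<Rightarrow>
    real \<Rightarrow> real \<Rightarrow> real \<Rightarrow> real set"
  where "elliptic_parameters w l1 l2 l3 =
    {t. 0 \<le> t \<and> ereal t < t_infinity l1 l2 l3 \<and>
      (\<exists>c1 c2 c3. ultra_parallel_triangle l1 l2 l3 c1 c2 c3 \<and>
        has_parameter c1 c2 c3 t \<and> elliptic (w c1 c2 c3))}"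

text \<open>In \<open>ereal\<close> the infimum of the empty set is \<open>\<infinity>\<close>.\<close>

definition type_A :: "real \<Rightarrow> real \<Rightarrow> real \<Rightarrow> bool"
  where "type_A l1 l2 l3 \<longleftrightarrow>
    Inf (ereal ` elliptic_parameters word_A l1 l2 l3) <
    Inf (ereal ` elliptic_parameters word_B l1 l2 l3)"

definition type_B :: "real \<Rightarrow> real \<Rightarrow> real \<Rightarrow> bool"
  where "type_B l1 l2 l3 \<longleftrightarrow> \<not> type_A l1 l2 l3"

end

theory Submission
  imports Defs
begin

text \<open>Under the identity the word \<open>w\<^sub>A\<close> is not elliptic for any parameter. Conjugating \<open>\<iota>\<^sub>2\<close> by
  \<open>\<iota>\<^sub>3\<close> shows that \<open>w\<^sub>A\<close> is the product of the reflections with polar vectors \<open>d = \<iota>\<^sub>3(c\<^sub>2)\<close> and \<open>c\<^sub>1\<close>,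
  and such a product has no fixed point in \<open>H\<^sup>2\<close> once \<open>\<bar>\<langle>d,c\<^sub>1\<rangle>\<bar> > 1\<close>. Here
  \<open>\<bar>\<langle>d,c\<^sub>1\<rangle>\<bar>\<^sup>2 = r\<^sub>3\<^sup>2 + 4 r\<^sub>1\<^sup>2 r\<^sub>2\<^sup>2 - 4 r\<^sub>1 r\<^sub>2 r\<^sub>3 cos \<alpha>\<close>, which for \<open>\<alpha> \<noteq> 0\<close> exceeds
  \<open>(2 r\<^sub>1 r\<^sub>2 - r\<^sub>3)\<^sup>2 = cosh\<^sup>2 ((\<ell>\<^sub>1 - \<ell>\<^sub>2) / 2) \<ge> 1\<close>. So the infimum for \<open>w\<^sub>A\<close> is infinite and
  the triangle cannot be of type A.\<close>

section \<open>Algebra of the Hermitian form and of projective representatives\<close>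

lemma herm_add_left: "herm (x + y) z = herm x z + herm y z"
  and herm_diff_left: "herm (x - y) z = herm x z - herm y z"
  and herm_minus_left: "herm (- x) z = - herm x z"
  and herm_scale_left: "herm (a *s x) z = a * herm x z"
  and herm_add_right: "herm z (x + y) = herm z x + herm z y"
  and herm_diff_right: "herm z (x - y) = herm z x - herm z y"
  and herm_minus_right: "herm z (- x) = - herm z x"
  and herm_scale_right: "herm z (a *s x) = cnj a * herm z x"
  by (simp_all add: herm_def algebra_simps)

lemmas herm_simps = herm_add_left herm_diff_left herm_minus_left herm_scale_left
  herm_add_right herm_diff_right herm_minus_right herm_scale_right

lemma herm_commute: "herm w z = cnj (herm z w)"
  by (simp add: herm_def mult.commute)

lemma Im_herm_self [simp]: "Im (herm z z) = 0"
  by (simp add: herm_def)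

lemma herm_self: "herm z z = complex_of_real (Re (herm z z))"
  by (simp add: complex_eq_iff)

lemma Re_herm_self: "Re (herm z z) = (cmod (z $ 1))\<^sup>2 + (cmod (z $ 2))\<^sup>2 - (cmod (z $ 3))\<^sup>2"
  unfolding herm_def cmod_power2 by (simp add: power2_eq_square)

lemma herm_mult_commute: "herm z w * herm w z = complex_of_real ((cmod (herm z w))\<^sup>2)"
  by (simp only: herm_commute[of w z] complex_norm_square[symmetric])

lemma proj_self: "z \<in> proj z"
proof -
  have "z = 1 *s z" by simp
  then show ?thesis unfolding proj_def by blast
qed

lemma Re_herm_scale: "Re (herm (a *s z) (a *s z)) = (cmod a)\<^sup>2 * Re (herm z z)"
proof -
  have "herm (a *s z) (a *s z) = (a * cnj a) * herm z z"
    by (simp add: herm_simps)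
  also have "\<dots> = complex_of_real ((cmod a)\<^sup>2 * Re (herm z z))"
    by (subst herm_self) (simp add: complex_norm_square del: of_real_power)
  finally show ?thesis by simp
qed

text \<open>Both conditions survive a change of representative: scaling multiplies
  \<open>Re (herm z z)\<close> by a squared modulus.\<close>

lemma proj_in_complex_geodesic:
  "proj z \<in> complex_geodesic c \<longleftrightarrow> negative z \<and> herm z c = 0"
proof
  assume "proj z \<in> complex_geodesic c"
  then obtain w where w: "proj z = proj w" "negative w" "herm w c = 0"
    unfolding complex_geodesic_def by auto
  obtain a where a: "z = a *s w" using proj_self[of z] w(1) unfolding proj_def by auto
  obtain b where b: "w = b *s z" using proj_self[of w] w(1) unfolding proj_def by auto
  have "(cmod b)\<^sup>2 * Re (herm z z) < 0"
    using w(2) Re_herm_scale[of b z] b unfolding negative_def by simp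
  then have "negative z" unfolding negative_def
    by (meson mult_nonneg_nonneg not_le zero_le_power2)
  moreover have "herm z c = 0" using a w(3) by (simp add: herm_simps)
  ultimately show "negative z \<and> herm z c = 0" by simp
qed (auto simp: complex_geodesic_def)

lemma nonpositive_third_nonzero:
  assumes "z \<noteq> 0" "Re (herm z z) \<le> 0"
  shows "z $ 3 \<noteq> 0"
proof
  assume "z $ 3 = 0"
  then have "z $ 1 = 0 \<and> z $ 2 = 0" using assms(2)
    by (simp add: Re_herm_self sum_power2_le_zero_iff)
  with \<open>z $ 3 = 0\<close> assms(1) show False by (simp add: vec_eq_iff forall_3)
qed

section \<open>Positivity on the complement of a negative vector\<close>

text \<open>This is signature (2,1) in usable form. Orthogonality expresses the product of the third
  coordinates by the other two; for nonpositive \<open>z\<close>, Cauchy-Schwarz in those two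
  coordinates contradicts the strict negativity of \<open>e\<close>.\<close>

lemma herm_pos_of_orthogonal_negative:
  assumes e: "negative e" and o: "herm z e = 0" and nz: "z \<noteq> 0"
  shows "0 < Re (herm z z)"
proof (rule ccontr)
  assume "\<not> 0 < Re (herm z z)"
  then have A: "(cmod (z $ 1))\<^sup>2 + (cmod (z $ 2))\<^sup>2 \<le> (cmod (z $ 3))\<^sup>2"
    by (simp add: Re_herm_self)
  have B: "(cmod (e $ 1))\<^sup>2 + (cmod (e $ 2))\<^sup>2 < (cmod (e $ 3))\<^sup>2"
    using e by (simp add: negative_def Re_herm_self)
  have z3: "z $ 3 \<noteq> 0"
    using nonpositive_third_nonzero[OF nz] \<open>\<not> 0 < Re (herm z z)\<close> by simp
  have eq: "z $ 3 * cnj (e $ 3) = z $ 1 * cnj (e $ 1) + z $ 2 * cnj (e $ 2)"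
    using o by (simp add: herm_def)
  have "cmod (z $ 3) * cmod (e $ 3) = cmod (z $ 1 * cnj (e $ 1) + z $ 2 * cnj (e $ 2))"
    using arg_cong[OF eq, of cmod] by (simp add: norm_mult)
  also have "\<dots> \<le> cmod (z $ 1) * cmod (e $ 1) + cmod (z $ 2) * cmod (e $ 2)"
    using norm_triangle_ineq[of "z $ 1 * cnj (e $ 1)" "z $ 2 * cnj (e $ 2)"]
    by (simp add: norm_mult)
  finally have "(cmod (z $ 3) * cmod (e $ 3))\<^sup>2 \<le>
      (cmod (z $ 1) * cmod (e $ 1) + cmod (z $ 2) * cmod (e $ 2))\<^sup>2"
    by (simp add: power_mono)
  also have "\<dots> \<le> ((cmod (z $ 1))\<^sup>2 + (cmod (z $ 2))\<^sup>2) * ((cmod (e $ 1))\<^sup>2 + (cmod (e $ 2))\<^sup>2)"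
    using zero_le_power2[of "cmod (z $ 1) * cmod (e $ 2) - cmod (z $ 2) * cmod (e $ 1)"]
    by (simp add: power2_eq_square algebra_simps)
  also have "\<dots> \<le> (cmod (z $ 3))\<^sup>2 * ((cmod (e $ 1))\<^sup>2 + (cmod (e $ 2))\<^sup>2)"
    using A by (intro mult_right_mono) auto
  also have "\<dots> < (cmod (z $ 3))\<^sup>2 * (cmod (e $ 3))\<^sup>2"
    using B z3 by (intro mult_strict_left_mono) auto
  finally show False by (simp add: power_mult_distrib)
qed

text \<open>The form is positive definite on the complement of \<open>e\<close>, so the classical
  argument applies: expand \<open>herm u u\<close> for \<open>u\<close>, a multiple of the part of
  \<open>z\<close> orthogonal to \<open>w\<close>.\<close>

lemma herm_Cauchy_Schwarz_orthogonal_negative: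
  assumes e: "negative e" and z: "herm z e = 0" and w: "herm w e = 0"
  shows "(cmod (herm z w))\<^sup>2 \<le> Re (herm z z) * Re (herm w w)"
proof (cases "w = 0")
  case True
  then show ?thesis by (simp add: herm_def)
next
  case False
  define Q where "Q = Re (herm w w)"
  have Q: "herm w w = of_real Q" unfolding Q_def by (rule herm_self)
  have "0 < Q" unfolding Q_def by (rule herm_pos_of_orthogonal_negative[OF e w False])
  define u where "u = of_real Q *s z - herm z w *s w"
  have u: "herm u e = 0" by (simp add: u_def herm_simps z w)
  have "0 \<le> Re (herm u u)"
  proof (cases "u = 0")
    case True then show ?thesis by (simp add: herm_def)
  next
    case False
    then show ?thesis using herm_pos_of_orthogonal_negative[OF e u] by simp
  qed
  moreover have "herm u u = of_real Q * (of_real Q * herm z z - herm z w * herm w z)"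
    by (simp add: u_def herm_simps Q herm_commute[of w z, symmetric] algebra_simps)
  then have "herm u u = of_real (Q * (Q * Re (herm z z) - (cmod (herm z w))\<^sup>2))"
    unfolding herm_mult_commute by (subst (asm) (2) herm_self) simp
  ultimately have "0 \<le> Q * (Q * Re (herm z z) - (cmod (herm z w))\<^sup>2)" by simp
  with \<open>0 < Q\<close> show ?thesis by (simp add: zero_le_mult_iff Q_def mult.commute)
qed

section \<open>Distance between ultra-parallel complex geodesics\<close>

text \<open>A Gram-Schmidt step: the part of \<open>c'\<close> orthogonal to \<open>c\<close>.
  Projectively it is the foot, on the geodesic polar to \<open>c\<close>, of the common
  perpendicular of the two geodesics.\<close>

lemma negative_projection:
  assumes "herm c c = 1" "herm c' c' = 1" "1 < cmod (herm c' c)"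
  shows "Re (herm (c' - herm c' c *s c) (c' - herm c' c *s c)) = 1 - (cmod (herm c' c))\<^sup>2"
    and "negative (c' - herm c' c *s c)"
proof -
  have "herm (c' - herm c' c *s c) (c' - herm c' c *s c) = 1 - herm c' c * herm c c'"
    by (simp add: herm_simps assms herm_commute[of c c', symmetric] algebra_simps)
  then show *: "Re (herm (c' - herm c' c *s c) (c' - herm c' c *s c)) = 1 - (cmod (herm c' c))\<^sup>2"
    unfolding herm_mult_commute by simp
  show "negative (c' - herm c' c *s c)"
    unfolding negative_def * using assms(3) by simp
qed

text \<open>AM-GM for \<open>A * Q\<close> and \<open>P * B\<close> bounds
  \<open>(A - P) * (B - Q)\<close> by the square of \<open>sqrt (A * B) - sqrt (P * Q)\<close>.
  Since \<open>r\<close> is at least 1, its factor on the subtracted root can then be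
  dropped.\<close>

lemma real_reverse_Cauchy_Schwarz:
  fixes A B P Q r :: real
  assumes "1 \<le> r" "0 \<le> P" "P \<le> A" "0 \<le> Q" "Q \<le> B"
  shows "r * sqrt ((A - P) * (B - Q)) \<le> r * sqrt (A * B) - sqrt (P * Q)"
proof -
  have le: "sqrt (P * Q) \<le> sqrt (A * B)" using assms by (intro real_sqrt_le_mono mult_mono) auto
  have "2 * (sqrt (A * Q) * sqrt (P * B)) \<le> A * Q + P * B"
    using sum_squares_bound[of "sqrt (A * Q)" "sqrt (P * B)"] assms by simp
  moreover have "sqrt (A * Q) * sqrt (P * B) = sqrt (A * B) * sqrt (P * Q)"
    by (simp add: real_sqrt_mult algebra_simps)
  ultimately have "(A - P) * (B - Q) \<le> (sqrt (A * B) - sqrt (P * Q))\<^sup>2"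
    using assms by (simp add: power2_diff algebra_simps)
  then have "sqrt ((A - P) * (B - Q)) \<le> sqrt (A * B) - sqrt (P * Q)"
    using le by (intro real_le_lsqrt) auto
  then have "r * sqrt ((A - P) * (B - Q)) \<le> r * (sqrt (A * B) - sqrt (P * Q))"
    using assms by (intro mult_left_mono) auto
  also have "\<dots> \<le> r * sqrt (A * B) - sqrt (P * Q)"
    using mult_right_mono[of 1 r "sqrt (P * Q)"] assms by (simp add: algebra_simps)
  finally show ?thesis .
qed

text \<open>Splitting off the span of \<open>c\<close> and \<open>c'\<close>, whose complement is positive definite, reduces the
  bound to the preceding real inequality.\<close>

lemma herm_lower_bound:
  assumes c: "herm c c = 1" "herm c' c' = 1" and r: "1 < cmod (herm c c')"
    and z: "negative z" "herm z c = 0" and w: "negative w" "herm w c' = 0"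
  shows "cmod (herm c c') * sqrt (Re (herm z z) * Re (herm w w)) \<le> cmod (herm z w)"
proof -
  define b where "b = herm c' c"
  define k where "k = (cmod b)\<^sup>2 - 1"
  have cb: "herm c c' = cnj b" unfolding b_def by (rule herm_commute)
  have rb: "1 < cmod b" using r cb by simp
  then have k: "0 < k" by (simp add: k_def)
  have bb: "b * cnj b = 1 + of_real k"
    by (simp add: k_def complex_norm_square del: of_real_power)
  define e where "e = c' - b *s c"
  define f where "f = c - cnj b *s c'"
  have ee: "herm e e = - of_real k" and ff: "herm f f = - of_real k"
    using bb by (simp_all add: e_def f_def herm_simps c cb b_def[symmetric] algebra_simps)
  have ef: "herm e f = b * of_real k"
    using bb by (simp add: e_def f_def herm_simps c cb b_def[symmetric] algebra_simps)
  have ec: "herm e c = 0" and fc: "herm f c' = 0"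
    by (simp_all add: e_def f_def herm_simps c cb b_def[symmetric])
  have neg: "negative e" using k by (simp add: negative_def ee)
  \<comment> \<open>As \<open>e\<close> and \<open>f\<close> both have norm \<open>-k\<close>, these
    are the coefficients of the orthogonal projections of \<open>z\<close> to \<open>e\<close> and
    of \<open>w\<close> to \<open>f\<close>.\<close>
  define x where "x = - herm z e / of_real k"
  define y where "y = - herm w f / of_real k"
  define z' where "z' = z - x *s e"
  define w' where "w' = w - y *s f"
  have z'e: "herm z' e = 0" using k by (simp add: z'_def x_def herm_simps ee)
  have w'f: "herm w' f = 0" using k by (simp add: w'_def y_def herm_simps ff)
  have z'c: "herm z' c = 0" by (simp add: z'_def herm_simps z ec)
  have w'c': "herm w' c' = 0" by (simp add: w'_def herm_simps w fc)
  \<comment> \<open>The remainders are orthogonal to both \<open>c\<close> and \<open>c'\<close>,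
    hence to both \<open>e\<close> and \<open>f\<close>. No mixed terms survive in
    \<open>herm z w\<close>, although \<open>z\<close> and \<open>w\<close> are split along
    different vectors.\<close>
  have z'c': "herm z' c' = 0" using z'e z'c by (simp add: e_def herm_simps)
  have w'c: "herm w' c = 0" using w'f w'c' by (simp add: f_def herm_simps)
  have z'f: "herm z' f = 0" by (simp add: f_def herm_simps z'c z'c')
  have w'e: "herm w' e = 0" by (simp add: e_def herm_simps w'c w'c')
  have ez': "herm e z' = 0" and fw': "herm f w' = 0" and ew': "herm e w' = 0"
    using z'e w'f w'e herm_commute[of e z'] herm_commute[of f w'] herm_commute[of e w'] by simp_all
  have zd: "z = x *s e + z'" and wd: "w = y *s f + w'" by (simp_all add: z'_def w'_def)
  define P where "P = Re (herm z' z')"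
  define Q where "Q = Re (herm w' w')"
  define A where "A = k * (cmod x)\<^sup>2"
  define B where "B = k * (cmod y)\<^sup>2"
  have "herm z z = of_real (- A) + herm z' z'"
    by (subst zd, subst zd)
      (simp add: herm_simps z'e ez' ee A_def complex_norm_square mult.assoc mult.left_commute
        del: of_real_power)
  then have zz: "Re (herm z z) = P - A" by (simp add: P_def)
  have "herm w w = of_real (- B) + herm w' w'"
    by (subst wd, subst wd)
      (simp add: herm_simps w'f fw' ff B_def complex_norm_square mult.assoc mult.left_commute
        del: of_real_power)
  then have ww: "Re (herm w w) = Q - B" by (simp add: Q_def)
  have zw: "herm z w = x * cnj y * (b * of_real k) + herm z' w'"
    by (subst zd, subst wd) (simp add: herm_simps z'f ew' ef algebra_simps)
  have nonneg: "0 \<le> Re (herm u u)" if "herm u e = 0" for u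
    using herm_pos_of_orthogonal_negative[OF neg that] by (cases "u = 0") (auto simp: herm_def)
  have P: "0 \<le> P" and Q: "0 \<le> Q" using nonneg z'e w'e by (auto simp: P_def Q_def)
  have "cmod (herm z' w') \<le> sqrt (P * Q)"
    using herm_Cauchy_Schwarz_orthogonal_negative[OF neg z'e w'e]
    by (intro real_le_rsqrt) (simp add: P_def Q_def)
  moreover have "cmod (x * cnj y * (b * of_real k)) = cmod b * sqrt (A * B)"
  proof -
    have "A * B = (k * (cmod x * cmod y))\<^sup>2" by (simp add: A_def B_def power2_eq_square)
    then have "sqrt (A * B) = k * (cmod x * cmod y)" using k by simp
    then show ?thesis using k by (simp add: norm_mult)
  qed
  ultimately have "cmod b * sqrt (A * B) - sqrt (P * Q) \<le> cmod (herm z w)"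
    unfolding zw using norm_diff_ineq[of "x * cnj y * (b * of_real k)" "herm z' w'"] by simp
  moreover have "cmod b * sqrt ((A - P) * (B - Q)) \<le> cmod b * sqrt (A * B) - sqrt (P * Q)"
    using rb P Q z(1) w(1) by (intro real_reverse_Cauchy_Schwarz) (auto simp: negative_def zz ww)
  moreover have "(A - P) * (B - Q) = Re (herm z z) * Re (herm w w)"
    by (simp add: zz ww algebra_simps)
  ultimately show ?thesis by (simp add: cb)
qed

text \<open>The bound of \<open>herm_lower_bound\<close> is attained at the feet \<open>e\<close>
  and \<open>f\<close> of the common perpendicular, so the infimum is a minimum.\<close>

lemma set_hyp_dist_complex_geodesic:
  assumes c: "herm c c = 1" "herm c' c' = 1" and r: "1 < cmod (herm c c')"
  shows "set_hyp_dist (complex_geodesic c) (complex_geodesic c') = 2 * arcosh (cmod (herm c c'))"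
  unfolding set_hyp_dist_def
proof (rule cInf_eq_minimum)
  define b where "b = herm c' c"
  have cb: "herm c c' = cnj b" unfolding b_def by (rule herm_commute)
  have rb: "1 < cmod b" using r cb by simp
  define e where "e = c' - herm c' c *s c"
  define f where "f = c - herm c c' *s c'"
  have ne: "negative e" "Re (herm e e) = 1 - (cmod b)\<^sup>2"
    unfolding e_def using negative_projection[OF c] rb by (auto simp: b_def)
  have nf: "negative f" "Re (herm f f) = 1 - (cmod b)\<^sup>2"
    unfolding f_def using negative_projection[OF c(2,1)] rb by (auto simp: cb)
  have o: "herm e c = 0" "herm f c' = 0"
    by (simp_all add: e_def f_def herm_simps c)
  have "herm e f = b * (b * cnj b - 1)"
    by (simp add: e_def f_def herm_simps c cb b_def[symmetric] algebra_simps)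
  also have "\<dots> = b * of_real ((cmod b)\<^sup>2 - 1)" by (simp add: complex_norm_square del: of_real_power)
  finally have "cmod (herm e f) = cmod b * \<bar>(cmod b)\<^sup>2 - 1\<bar>"
    by (simp only: norm_mult norm_of_real)
  moreover have "0 < (cmod b)\<^sup>2 - 1" using rb by simp
  moreover have "sqrt (Re (herm e e) * Re (herm f f)) = \<bar>(cmod b)\<^sup>2 - 1\<bar>"
    unfolding ne nf by (simp add: abs_minus_commute)
  ultimately have "hyp_dist e f = 2 * arcosh (cmod b)" by (simp add: hyp_dist_def)
  then have "2 * arcosh (cmod (herm c c')) = hyp_dist e f" by (simp add: cb)
  then show "2 * arcosh (cmod (herm c c'))
      \<in> {hyp_dist z w |z w. proj z \<in> complex_geodesic c \<and> proj w \<in> complex_geodesic c'}"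
    using o ne(1) nf(1) by (simp only: proj_in_complex_geodesic mem_Collect_eq) blast
next
  fix d assume "d \<in> {hyp_dist z w |z w. proj z \<in> complex_geodesic c \<and> proj w \<in> complex_geodesic c'}"
  then obtain z w where d: "d = hyp_dist z w" and z: "negative z" "herm z c = 0"
    and w: "negative w" "herm w c' = 0"
    by (auto simp: proj_in_complex_geodesic)
  have "0 < sqrt (Re (herm z z) * Re (herm w w))"
    using z(1) w(1) by (simp add: negative_def mult_neg_neg)
  then have "cmod (herm c c') \<le> cmod (herm z w) / sqrt (Re (herm z z) * Re (herm w w))"
    using herm_lower_bound[OF c r z w] by (simp add: pos_le_divide_eq)
  then show "2 * arcosh (cmod (herm c c')) \<le> d"
    unfolding d hyp_dist_def using r by (simp flip: not_less)
qed

section \<open>Ultra-parallelism in terms of polar vectors\<close>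

text \<open>\<open>m\<close> is the projection of the negative basis vector to the complement of
  \<open>c\<close>. The formula for general \<open>w\<close> gives orthogonality to \<open>c\<close>
  and, later, to a second polar vector parallel to \<open>c\<close>.\<close>

lemma negative_orthogonal_to_unit:
  fixes c :: "complex ^ 3"
  assumes "herm c c = 1"
  defines "m \<equiv> axis 3 1 + cnj (c $ 3) *s c"
  shows "negative m" and "herm m w = - cnj (w $ 3) + cnj (c $ 3) * herm c w"
proof -
  have ax: "herm (axis 3 1) w = - cnj (w $ 3)" "herm w (axis 3 1) = - w $ 3"
    "(axis 3 1 :: complex ^ 3) $ 3 = 1" for w
    by (simp_all add: herm_def axis_def)
  show "herm m w = - cnj (w $ 3) + cnj (c $ 3) * herm c w"
    by (simp add: m_def herm_simps ax)
  have "herm m m = - (1 + c $ 3 * cnj (c $ 3))"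
    by (simp add: m_def herm_simps ax assms(1) algebra_simps)
  also have "\<dots> = - of_real (1 + (cmod (c $ 3))\<^sup>2)"
    by (simp add: complex_norm_square del: of_real_power)
  finally have "Re (herm m m) = - (1 + (cmod (c $ 3))\<^sup>2)" by simp
  then show "negative m"
    unfolding negative_def using zero_le_power2[of "cmod (c $ 3)"] by linarith
qed

text \<open>Null vectors are allowed, so ideal points are covered. They are limits of negative
  points obtained by perturbing along a negative vector of the same orthogonal complement.\<close>

lemma chart_point_in_closure:
  assumes c: "herm c c = 1" and z: "z \<noteq> 0" "Re (herm z z) \<le> 0" "herm z c = 0"
  shows "vector [z $ 1 / z $ 3, z $ 2 / z $ 3] \<in> closure (ball_chart (complex_geodesic c))"
proof -
  obtain m where m: "negative m" "herm m c = 0"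
    using negative_orthogonal_to_unit[OF c] c by fastforce
  \<comment> \<open>the sign makes the perturbation \<open>z + eps m\<close> negative even when \<open>z\<close> is null\<close>
  define s :: real where "s = (if Re (herm m z) \<le> 0 then 1 else - 1)"
  define eps where "eps n = s / real (Suc n)" for n
  define v where "v n = z + complex_of_real (eps n) *s m" for n
  have s: "s * Re (herm m z) \<le> 0" "s \<noteq> 0" by (auto simp: s_def)
  have vn: "negative (v n)" for n
  proof -
    have "Re (herm (v n) (v n)) = Re (herm z z) + 2 * (eps n * Re (herm m z)) + (eps n)\<^sup>2 * Re (herm m m)"
      using arg_cong[OF herm_commute[of z m], of Re]
      by (simp add: v_def herm_simps power2_eq_square algebra_simps)
    moreover have "eps n * Re (herm m z) \<le> 0"
      using s by (simp add: eps_def divide_le_0_iff)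
    moreover have "(eps n)\<^sup>2 * Re (herm m m) < 0"
      using m(1) s(2) by (simp add: negative_def mult_pos_neg eps_def)
    ultimately show ?thesis using z(2) by (simp add: negative_def)
  qed
  have vc: "herm (v n) c = 0" for n by (simp add: v_def herm_simps z m)
  have "eps \<longlonglongrightarrow> 0"
    unfolding eps_def by (rule LIMSEQ_Suc[OF lim_const_over_n[of s]])
  then have lim: "(\<lambda>n. v n $ i) \<longlonglongrightarrow> z $ i" for i
    unfolding v_def by (auto intro!: tendsto_eq_intros)
  have "z $ 3 \<noteq> 0" using nonpositive_third_nonzero[OF z(1,2)] .
  then have "\<forall>i. (\<lambda>n. (vector [v n $ 1 / v n $ 3, v n $ 2 / v n $ 3] :: complex ^ 2) $ i)
      \<longlonglongrightarrow> (vector [z $ 1 / z $ 3, z $ 2 / z $ 3] :: complex ^ 2) $ i"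
    by (simp add: forall_2 tendsto_divide lim)
  then have "(\<lambda>n. vector [v n $ 1 / v n $ 3, v n $ 2 / v n $ 3] :: complex ^ 2)
      \<longlonglongrightarrow> vector [z $ 1 / z $ 3, z $ 2 / z $ 3]"
    by (intro vec_tendstoI) simp
  moreover have "vector [v n $ 1 / v n $ 3, v n $ 2 / v n $ 3] \<in> ball_chart (complex_geodesic c)" for n
    using vn vc unfolding ball_chart_def by (auto simp: proj_in_complex_geodesic)
  ultimately show ?thesis unfolding closure_sequential
    by (intro exI[of _ "\<lambda>n. vector [v n $ 1 / v n $ 3, v n $ 2 / v n $ 3]"]) simp
qed

text \<open>Supplies a common point of the two closures, ruling out ultra-parallelism. For
  independent \<open>c\<close> and \<open>c'\<close> it is their cross product, of norm
  \<open>(cmod (herm c c'))\<^sup>2 - 1\<close>; otherwise any negative vector orthogonal to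
  \<open>c\<close> serves.\<close>

lemma common_orthogonal_nonpositive:
  assumes c: "herm c c = 1" "herm c' c' = 1" and r: "cmod (herm c c') \<le> 1"
  shows "\<exists>z. z \<noteq> 0 \<and> Re (herm z z) \<le> 0 \<and> herm z c = 0 \<and> herm z c' = 0"
proof -
  \<comment> \<open>the cross product for the form: it vanishes iff \<open>c\<close>, \<open>c'\<close> are parallel\<close>
  define z :: "complex ^ 3" where "z = vector
    [cnj (c $ 3 * c' $ 2 - c $ 2 * c' $ 3), cnj (c $ 1 * c' $ 3 - c $ 3 * c' $ 1),
     cnj (c $ 1 * c' $ 2 - c $ 2 * c' $ 1)]"
  show ?thesis
  proof (cases "z = 0")
    case False
    have "herm z z = herm c c' * herm c' c - herm c c * herm c' c'"
      by (simp add: z_def herm_def algebra_simps)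
    then have "Re (herm z z) = (cmod (herm c c'))\<^sup>2 - 1"
      unfolding herm_mult_commute c by simp
    moreover have "(cmod (herm c c'))\<^sup>2 \<le> 1" using r by (simp add: power_le_one)
    moreover have "herm z c = 0" "herm z c' = 0"
      by (simp_all add: z_def herm_def algebra_simps)
    ultimately show ?thesis using False by (intro exI[of _ z]) simp
  next
    case True
    then have par: "c $ 3 * c' $ 2 = c $ 2 * c' $ 3" "c $ 1 * c' $ 3 = c $ 3 * c' $ 1"
      by (simp_all add: z_def vec_eq_iff forall_3 flip: complex_cnj_mult complex_cnj_diff)
    \<comment> \<open>Since \<open>herm c c\<close> is 1, this says exactly that the vector
      \<open>m\<close> below is orthogonal to \<open>c'\<close> as well.\<close>
    have "cnj (c $ 3) * herm c c' = cnj (c' $ 3) * herm c c"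
      using arg_cong[OF par(1), of cnj] arg_cong[OF par(2), of cnj]
      unfolding herm_def complex_cnj_mult by algebra
    moreover obtain m where "negative m" "\<And>w. herm m w = - cnj (w $ 3) + cnj (c $ 3) * herm c w"
      using negative_orthogonal_to_unit[OF c(1)] by blast
    moreover from this have "m \<noteq> 0" by (auto simp: negative_def herm_def)
    ultimately show ?thesis using c by (intro exI[of _ m]) (auto simp: negative_def)
  qed
qed

lemma cmod_herm_gt_1_of_ultra_parallel:
  assumes c: "herm c c = 1" "herm c' c' = 1"
    and "ultra_parallel (complex_geodesic c) (complex_geodesic c')"
  shows "1 < cmod (herm c c')"
proof (rule ccontr)
  assume "\<not> 1 < cmod (herm c c')"
  then obtain z where "z \<noteq> 0" "Re (herm z z) \<le> 0" "herm z c = 0" "herm z c' = 0"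
    using common_orthogonal_nonpositive[OF c] by auto
  then show False
    using chart_point_in_closure[of c z] chart_point_in_closure[of c' z] c assms(3)
    unfolding ultra_parallel_def by blast
qed

lemma cmod_herm_eq_cosh:
  assumes c: "herm c c = 1" "herm c' c' = 1"
    and u: "ultra_parallel (complex_geodesic c) (complex_geodesic c')"
    and l: "set_hyp_dist (complex_geodesic c) (complex_geodesic c') = l"
  shows "cmod (herm c c') = cosh (l / 2)"
  using set_hyp_dist_complex_geodesic[OF c cmod_herm_gt_1_of_ultra_parallel[OF c u]]
    cmod_herm_gt_1_of_ultra_parallel[OF c u] l by auto

section \<open>Complex reflections and fixed points of their products\<close>

lemma complex_reflection_involution:
  assumes "herm c c = 1"
  shows "complex_reflection c (complex_reflection c z) = z"
  by (simp add: complex_reflection_def herm_simps assms vec_eq_iff algebra_simps)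

lemma herm_complex_reflection:
  assumes "herm c c = 1"
  shows "herm (complex_reflection c z) (complex_reflection c w) = herm z w"
  by (simp add: complex_reflection_def herm_simps assms herm_commute[of c w] algebra_simps)

text \<open>Conjugating by an isometry moves the polar vector; this shortens the four-letter
  \<open>word_A\<close> to two reflections.\<close>

lemma complex_reflection_conjugate:
  assumes "herm c c = 1"
  shows "complex_reflection c (complex_reflection d (complex_reflection c z)) =
    complex_reflection (complex_reflection c d) z"
proof -
  have "herm (complex_reflection c z) d = herm z (complex_reflection c d)"
    using herm_complex_reflection[OF assms, of "complex_reflection c z" d]
    by (simp add: complex_reflection_involution[OF assms])
  then show ?thesis
    by (simp add: complex_reflection_def[of d] complex_reflection_def[of "complex_reflection c d"])
      (simp add: complex_reflection_def herm_simps assms vec_eq_iff algebra_simps)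
qed

lemma complex_reflection_scale: "complex_reflection c (a *s z) = a *s complex_reflection c z"
  by (simp add: complex_reflection_def herm_simps vec_eq_iff algebra_simps)

text \<open>A negative fixed line would be spanned by an eigenvector with eigenvalue of modulus 1,
  which is forced to be orthogonal to \<open>c\<close> and \<open>d\<close>. But their span contains
  a negative vector, so its complement is positive.\<close>

lemma not_elliptic_product_of_reflections:
  assumes c: "herm c c = 1" "herm d d = 1" and g: "1 < cmod (herm d c)"
  shows "\<not> elliptic (complex_reflection d \<circ> complex_reflection c)"
proof
  assume "elliptic (complex_reflection d \<circ> complex_reflection c)"
  then obtain z where z: "negative z"
    and img: "(complex_reflection d \<circ> complex_reflection c) ` proj z = proj z"
    unfolding elliptic_def H2C_def by auto
  then obtain a where a: "complex_reflection d (complex_reflection c z) = a *s z"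
    using imageI[OF proj_self, of "complex_reflection d \<circ> complex_reflection c" z]
    unfolding img by (auto simp: proj_def)
  have "herm (a *s z) (a *s z) = herm z z"
    unfolding a[symmetric] by (simp add: herm_complex_reflection c)
  then have "(cmod a)\<^sup>2 * Re (herm z z) = Re (herm z z)" by (metis Re_herm_scale)
  then have "(cmod a)\<^sup>2 = 1" using z by (simp add: negative_def)
  then have na: "cmod a = 1" using norm_ge_zero[of a] by (simp add: power2_eq_1_iff)
  have eq: "complex_reflection c z = a *s complex_reflection d z"
    using arg_cong[OF a, of "complex_reflection d"]
    by (simp add: complex_reflection_involution c complex_reflection_scale)
  \<comment> \<open>pairing \<open>eq\<close> with \<open>c\<close> and \<open>d\<close> gives \<open>\<bar>h\<bar> \<bar>y\<bar> \<le> \<bar>x\<bar>\<close> and \<open>\<bar>h\<bar> \<bar>x\<bar> \<le> \<bar>y\<bar>\<close>, hence \<open>x = y = 0\<close>\<close>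
  define x y h where "x = herm z c" and "y = herm z d" and "h = herm d c"
  have hc: "herm c d = cnj h" unfolding h_def by (rule herm_commute)
  have "herm (complex_reflection c z) c = a * herm (complex_reflection d z) c"
    by (simp add: eq herm_simps)
  then have 1: "(1 + a) * x = 2 * a * h * y"
    by (simp add: complex_reflection_def herm_simps c x_def[symmetric] y_def[symmetric]
        h_def[symmetric] algebra_simps)
  have "herm (complex_reflection c z) d = a * herm (complex_reflection d z) d"
    by (simp add: eq herm_simps)
  then have 2: "(1 + a) * y = 2 * cnj h * x"
    by (simp add: complex_reflection_def herm_simps c x_def[symmetric] y_def[symmetric]
        hc algebra_simps)
  have hn: "1 < cmod h" using g by (simp add: h_def)
  have n1: "cmod (1 + a) \<le> 2" using norm_triangle_ineq[of 1 a] na by simp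
  have nx: "cmod h * (2 * cmod y) \<le> 2 * cmod x"
    using arg_cong[OF 1, of cmod] na mult_right_mono[OF n1, of "cmod x"]
    by (simp add: norm_mult)
  have ny: "cmod h * (2 * cmod x) \<le> 2 * cmod y"
    using arg_cong[OF 2, of cmod] mult_right_mono[OF n1, of "cmod y"]
    by (simp add: norm_mult)
  have "x = 0 \<and> y = 0"
  proof -
    have "cmod y \<le> cmod h * cmod y" "cmod x \<le> cmod h * cmod x"
      using mult_right_mono[of 1 "cmod h"] hn by auto
    with nx ny have "cmod x = cmod y" "cmod h * cmod x = cmod x" by linarith+
    then show ?thesis using hn by auto
  qed
  then have "herm z (d - herm d c *s c) = 0"
    by (simp add: herm_simps x_def y_def)
  moreover have "z \<noteq> 0" using z by (auto simp: negative_def herm_def)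
  ultimately show False
    using herm_pos_of_orthogonal_negative[OF negative_projection(2)[OF c g]] z
    by (fastforce simp: negative_def)
qed

section \<open>Angular invariant and side lengths of the triangle\<close>

lemma Re_less_cmod_of_Arg:
  assumes "Arg z \<noteq> 0"
  shows "Re z < cmod z"
proof (rule ccontr)
  assume "\<not> Re z < cmod z"
  then have "Re z = cmod z" using complex_Re_le_cmod[of z] by simp
  then have "Im z = 0" using cmod_power2[of z] by simp
  with \<open>Re z = cmod z\<close> assms show False
    by (metis Arg_eq_0 complex_is_Real_iff norm_ge_zero)
qed

text \<open>The pairing is a difference of two terms; their cross term is the conjugate of the
  triple product defining the angular invariant, with the same real part.\<close>

lemma cmod_herm_reflection:
  "(cmod (herm (complex_reflection c3 c2) c1))\<^sup>2 =
    (cmod (herm c2 c1))\<^sup>2 + 4 * (cmod (herm c3 c2))\<^sup>2 * (cmod (herm c1 c3))\<^sup>2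
      - 4 * Re (herm c3 c2 * herm c1 c3 * herm c2 c1)"
proof -
  have *: "herm (complex_reflection c3 c2) c1 =
      2 * cnj (herm c3 c2) * cnj (herm c1 c3) - herm c2 c1"
    by (simp add: complex_reflection_def herm_simps herm_commute[of c2 c3] herm_commute[of c3 c1])
  show ?thesis
    unfolding * cmod_power2 by (simp add: power2_eq_square algebra_simps)
qed

text \<open>The difference of the two sides factors as
  \<open>(cosh l3 - cosh (l1 + l2)) * (cosh l3 - cosh (l2 - l1))\<close>. The second factor cannot
  vanish because \<open>l2 - l1\<close> is nonnegative and below \<open>l3\<close>. It is later
  applied to half-lengths.\<close>

lemma cosh_triangle_identity_iff:
  fixes l1 l2 l3 :: real
  assumes "0 < l1" "l1 \<le> l2" "l2 \<le> l3"
  shows "(cosh l1)\<^sup>2 + (cosh l2)\<^sup>2 + (cosh l3)\<^sup>2 = 1 + 2 * cosh l1 * cosh l2 * cosh l3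
    \<longleftrightarrow> l3 = l1 + l2"
proof -
  have "(cosh l1)\<^sup>2 + (cosh l2)\<^sup>2 + (cosh l3)\<^sup>2 - (1 + 2 * cosh l1 * cosh l2 * cosh l3) =
      (cosh l3 - cosh (l1 + l2)) * (cosh l3 - cosh (l2 - l1))"
    unfolding cosh_add cosh_diff using cosh_square_eq[of l1] cosh_square_eq[of l2] by algebra
  then have "(cosh l1)\<^sup>2 + (cosh l2)\<^sup>2 + (cosh l3)\<^sup>2 = 1 + 2 * cosh l1 * cosh l2 * cosh l3
      \<longleftrightarrow> cosh l3 = cosh (l1 + l2) \<or> cosh l3 = cosh (l2 - l1)"
    by (metis eq_iff_diff_eq_0 mult_eq_0_iff)
  moreover have "cosh l3 = cosh (l1 + l2) \<longleftrightarrow> l3 = l1 + l2"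
    using assms by (metis add_nonneg_nonneg arcosh_cosh_real less_imp_le order_trans)
  moreover have "cosh l3 \<noteq> cosh (l2 - l1)"
    using assms cosh_real_nonneg_less_iff[of "l2 - l1" l3] by simp
  ultimately show ?thesis by simp
qed

lemma elliptic_parameters_word_A_empty:
  assumes "l3 = l1 + l2"
  shows "elliptic_parameters word_A l1 l2 l3 = {}"
proof -
  have "\<not> elliptic (word_A c1 c2 c3)"
    if tri: "ultra_parallel_triangle l1 l2 l3 c1 c2 c3" and par: "has_parameter c1 c2 c3 t"
    for c1 c2 c3 t
  proof -
    have c: "herm c1 c1 = 1" "herm c2 c2 = 1" "herm c3 c3 = 1"
      using tri by (simp_all add: ultra_parallel_triangle_def)
    have r: "cmod (herm c3 c2) = cosh (l1 / 2)" "cmod (herm c1 c3) = cosh (l2 / 2)"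
      "cmod (herm c2 c1) = cosh (l3 / 2)"
      using tri by (auto simp: ultra_parallel_triangle_def intro!: cmod_herm_eq_cosh)
    define d where "d = complex_reflection c3 c2"
    have "Arg (herm c3 c2 * herm c1 c3 * herm c2 c1) \<noteq> 0"
      using par by (simp add: has_parameter_def angular_invariant_def)
    from Re_less_cmod_of_Arg[OF this]
    have "Re (herm c3 c2 * herm c1 c3 * herm c2 c1) < cosh (l1 / 2) * cosh (l2 / 2) * cosh (l3 / 2)"
      unfolding norm_mult r .
    \<comment> \<open>Replacing the real part by its strict upper bound, the value for a vanishing
      angular invariant, completes the square.\<close>
    then have "(2 * cosh (l1 / 2) * cosh (l2 / 2) - cosh (l3 / 2))\<^sup>2 < (cmod (herm d c1))\<^sup>2"
      unfolding d_def cmod_herm_reflection r by (simp add: power2_eq_square algebra_simps)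
    moreover have "2 * cosh (l1 / 2) * cosh (l2 / 2) - cosh (l3 / 2) = cosh (l1 / 2 - l2 / 2)"
      by (simp add: assms add_divide_distrib cosh_add cosh_diff)
    ultimately have "cosh (l1 / 2 - l2 / 2) < cmod (herm d c1)"
      by (metis norm_ge_zero power_less_imp_less_base)
    then have "1 < cmod (herm d c1)"
      using cosh_real_ge_1[of "l1 / 2 - l2 / 2"] by linarith
    then have "\<not> elliptic (complex_reflection d \<circ> complex_reflection c1)"
      using c by (intro not_elliptic_product_of_reflections) (auto simp: d_def herm_complex_reflection)
    moreover have "word_A c1 c2 c3 = complex_reflection d \<circ> complex_reflection c1"
      by (simp add: word_A_def d_def fun_eq_iff complex_reflection_conjugate c)
    ultimately show ?thesis by simp
  qed
  then show ?thesis by (auto simp: elliptic_parameters_def)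
qed

theorem proposition15:
  fixes l1 l2 l3 r1 r2 r3 :: real
  assumes "0 < l1" and "l1 \<le> l2" and "l2 \<le> l3"
    and "r1 = cosh (l1 / 2)" and "r2 = cosh (l2 / 2)" and "r3 = cosh (l3 / 2)"
  shows "(r1\<^sup>2 + r2\<^sup>2 + r3\<^sup>2 = 1 + 2 * r1 * r2 * r3 \<longleftrightarrow> l3 = l1 + l2) \<and>
    (r1\<^sup>2 + r2\<^sup>2 + r3\<^sup>2 = 1 + 2 * r1 * r2 * r3 \<longrightarrow> type_B l1 l2 l3)"
proof -
  have "r1\<^sup>2 + r2\<^sup>2 + r3\<^sup>2 = 1 + 2 * r1 * r2 * r3 \<longleftrightarrow> l3 / 2 = l1 / 2 + l2 / 2"
    unfolding assms(4-6) using assms(1-3) by (intro cosh_triangle_identity_iff) auto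
  also have "\<dots> \<longleftrightarrow> l3 = l1 + l2"
    by linarith
  finally have "r1\<^sup>2 + r2\<^sup>2 + r3\<^sup>2 = 1 + 2 * r1 * r2 * r3 \<longleftrightarrow> l3 = l1 + l2" .
  moreover have "type_B l1 l2 l3" if "l3 = l1 + l2"
    using elliptic_parameters_word_A_empty[OF that]
    by (simp add: type_B_def type_A_def top_ereal_def)
  ultimately show ?thesis by blast
qed

end
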